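(* Let $z_1,\dots,z_m\in\partial\mathbb{D}$ be distinct, $\mu=\sum_{j=1}^m\mu_j\delta_{z_j}$ with $\mu_j>0$, $\sum\mu_j=1$, and $G$ real-valued on $\{z_1,\dots,z_m\}$, numbered so that $G(z_1)\ge\cdots\ge G(z_m)$. Let $K_1,\dots,K_L$ be the $K$-groups $K_i=\{k_{i-1}+1,\dots,k_i\}$ ($k_0=0$, $k_L=m$), i.e. maximal blocks of consecutive indices on which $G(z_\cdot)$ is constant. Let $\mu_t=e^{tG}\mu/\int e^{tG}d\mu$ and fix $n\in K_r$. Then there exist $r_0>0$, $T\ge0$ and $C$ such that for all $t\ge T$ and each $j=1,\dots,k_{r-1}$, the disk $\{z:|z-z_j|<r_0\}$ contains exactly one zero $z_j^{(n)}(t)$ of $\Phi_n(z;\mu_t)$, and \[ |z_j^{(n)}(t)-z_j|\le C\exp\bigl(t[G(z_n)-G(z_j)]\bigr). \]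
   Context: $\Phi_n(z;\nu)$ denotes the monic orthogonal polynomial of degree $n$ for a positive measure $\nu$ on $\partial\mathbb{D}$ whose support has at least $n$ points (the unique monic degree-$n$ polynomial orthogonal in $L^2(\nu)$ to all lower-degree polynomials). *)

theory Defs
  imports "HOL-Analysis.Analysis" "HOL-Computational_Algebra.Polynomial"
begin

text \<open>A finite discrete measure on the unit circle, given by points z 1, ..., z m
  with weights w 1, ..., w m. The L2 inner product of two polynomials.\<close>
definition disc_ip :: "nat \<Rightarrow> (nat \<Rightarrow> complex) \<Rightarrow> (nat \<Rightarrow> real) \<Rightarrow> complex poly \<Rightarrow> complex poly \<Rightarrow> complex" where
  "disc_ip m z w p q = (\<Sum>j=1..m. of_real (w j) * poly p (z j) * cnj (poly q (z j)))"

definition monic_OP :: "nat \<Rightarrow> (nat \<Rightarrow> complex) \<Rightarrow> (nat \<Rightarrow> real) \<Rightarrow> nat \<Rightarrow> complex poly" where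
  "monic_OP m z w n = (THE p. degree p = n \<and> lead_coeff p = 1 \<and>
      (\<forall>q. degree q < n \<longrightarrow> disc_ip m z w p q = 0))"

definition tilted_weights :: "nat \<Rightarrow> (nat \<Rightarrow> complex) \<Rightarrow> (nat \<Rightarrow> real) \<Rightarrow> (complex \<Rightarrow> real) \<Rightarrow> real \<Rightarrow> nat \<Rightarrow> real" where
  "tilted_weights m z mu G t j =
     exp (t * G (z j)) * mu j / (\<Sum>l=1..m. exp (t * G (z l)) * mu l)"

text \<open>For n in the K-group K_r = {k_(r-1)+1, ..., k_r} (maximal block of consecutive indices
  on which G(z_.) is constant), this is k_(r-1).\<close>
definition kgroup_prev :: "(nat \<Rightarrow> complex) \<Rightarrow> (complex \<Rightarrow> real) \<Rightarrow> nat \<Rightarrow> nat" where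
  "kgroup_prev z G n = (LEAST k. k < n \<and> (\<forall>l\<in>{k+1..n}. G (z l) = G (z n)))"

end

theory Submission
  imports Defs "HOL-Computational_Algebra.Fundamental_Theorem_Algebra"
begin

text \<open>Three applications of orthogonality. First, if \<open>\<Phi> = (X - x) q\<close>, testing with \<open>q\<close> gives
  \<open>\<bar>x\<bar> \<le> 1\<close>, so \<open>\<Phi>\<close> is bounded by \<open>2\<^sup>n\<close> on the circle. Second, if \<open>\<Phi> = (X - a) (X - b) s\<close> with
  \<open>a\<close> and \<open>b\<close> close to \<open>z\<^sub>j\<close>, testing with \<open>(X - z\<^sub>j) s\<close> kills the \<open>j\<close>-th term and leaves positive
  multiples of numbers near \<open>(z\<^sub>l - z\<^sub>j) \<bar>z\<^sub>l - z\<^sub>j\<bar>\<^sup>2\<close>, all of which lie strictly on one side of a line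
  through the origin because the \<open>z\<^sub>l\<close> lie on the circle; hence \<open>s = 0\<close>. So near \<open>z\<^sub>j\<close> there is at
  most one zero, for every choice of positive weights. Third, testing with
  \<open>\<Prod>\<^sub>i\<^sub>\<noteq>\<^sub>j (X - z\<^sub>i)\<close> over the indices \<open>i \<le> k\<^sub>r\<^sub>-\<^sub>1\<close> bounds \<open>\<bar>\<Phi>(z\<^sub>j)\<bar>\<close> by a multiple of
  \<open>exp (t (G(z\<^sub>n) - G(z\<^sub>j)))\<close>. A monic polynomial that is small at \<open>z\<^sub>j\<close> has a zero nearby, and the
  distance to this zero is controlled since the remaining zeros stay away.\<close>

section \<open>Monic polynomials through their zeros, and an inequality on the unit circle\<close>

lemma monic_complex_factorization:
  fixes p :: "complex poly"
  assumes "lead_coeff p = 1"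
  obtains A where "size A = degree p" "\<And>u. poly p u = (\<Prod>x\<in>#A. u - x)"
    "\<And>x. x \<in># A \<Longrightarrow> poly p x = 0"
proof -
  have "p \<noteq> 0" using assms by auto
  then obtain A where A: "size A = degree p" "p = smult (lead_coeff p) (\<Prod>x\<in>#A. [:-x, 1:])"
    using alg_closed_imp_factorization by blast
  have e: "poly p u = (\<Prod>x\<in>#A. u - x)" for u
    by (subst A(2)) (simp add: assms poly_prod_mset)
  moreover have "poly p x = 0" if "x \<in># A" for x
    using that by (auto simp: e prod_mset_zero_iff)
  ultimately show ?thesis using A(1) that by blast
qed

text \<open>Serves twice: in contrapositive form it produces a zero near a point where
  \<open>p\<close> is small, and directly it bounds a cofactor from below.\<close>

lemma norm_monic_poly_ge:
  fixes p :: "complex poly"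
  assumes "lead_coeff p = 1" "r \<ge> 0" "\<And>x. poly p x = 0 \<Longrightarrow> r \<le> dist x u"
  shows "r ^ degree p \<le> norm (poly p u)"
proof -
  obtain A where A: "size A = degree p" "\<And>u. poly p u = (\<Prod>x\<in>#A. u - x)"
    "\<And>x. x \<in># A \<Longrightarrow> poly p x = 0"
    using monic_complex_factorization[OF assms(1)] by metis
  have "r ^ size A \<le> norm (\<Prod>x\<in>#A. u - x)" if "\<And>x. x \<in># A \<Longrightarrow> r \<le> dist x u"
    using that
  proof (induction A)
    case (add x A)
    have "r \<le> norm (u - x)" using add.prems[of x] by (simp add: dist_norm norm_minus_commute)
    then show ?case using add assms(2) by (simp add: norm_mult mult_mono)
  qed simp
  then show ?thesis using A assms(3) by (metis)
qed

lemma norm_monic_poly_le: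
  fixes p :: "complex poly"
  assumes "lead_coeff p = 1" "\<And>x. poly p x = 0 \<Longrightarrow> dist x u \<le> R"
  shows "norm (poly p u) \<le> R ^ degree p"
proof -
  obtain A where A: "size A = degree p" "\<And>u. poly p u = (\<Prod>x\<in>#A. u - x)"
    "\<And>x. x \<in># A \<Longrightarrow> poly p x = 0"
    using monic_complex_factorization[OF assms(1)] by metis
  have "norm (\<Prod>x\<in>#A. u - x) \<le> R ^ size A" if "\<And>x. x \<in># A \<Longrightarrow> dist x u \<le> R"
    using that
  proof (induction A)
    case (add x A)
    have "norm (u - x) \<le> R" using add.prems[of x] by (simp add: dist_norm norm_minus_commute)
    moreover have "0 \<le> R" using calculation norm_ge_zero order_trans by blast
    ultimately show ?case using add by (simp add: norm_mult mult_mono)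
  qed simp
  then show ?thesis using A assms(2) by metis
qed

lemma monic_linear_factor:
  fixes p q :: "complex poly"
  assumes "p = [:-a, 1:] * q" "lead_coeff p = 1"
  shows "lead_coeff q = 1" "degree p = Suc (degree q)"
proof -
  have "q \<noteq> 0" using assms by auto
  then show "degree p = Suc (degree q)"
    unfolding assms(1) by (subst degree_mult_eq) auto
  show "lead_coeff q = 1" using assms by (simp add: lead_coeff_mult del: mult_pCons_left)
qed

text \<open>For \<open>a = b = u\<close> the product is |D|^2 * (- cnj u * D) with D = v - u. Since
  u and v lie on the circle, Re (- cnj u * D) = |D|^2 / 2, so its real part is |D|^4 / 2. This
  margin is of fourth order in |D|, which is why a and b must be within order d^2 of u.\<close>

lemma Re_circle_perturbation_pos:
  fixes u v a b :: complex
  assumes u: "norm u = 1" and v: "norm v = 1" and d: "0 < d" "d \<le> dist v u"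
    and a: "dist a u < d\<^sup>2 / 8" and b: "dist b u < d\<^sup>2 / 8"
  shows "0 < Re (- cnj u * ((v - a) * (v - b) * cnj (v - u)))"
proof -
  define D x y where "D = v - u" and "x = a - u" and "y = b - u"
  define N where "N = norm D"
  define r where "r = d\<^sup>2 / 8"
  have N: "d \<le> N" "N \<le> 2"
    using d norm_triangle_ineq4[of v u] u v by (auto simp: N_def D_def dist_norm)
  have xy: "norm x \<le> r" "norm y \<le> r"
    using a b by (auto simp: x_def y_def r_def dist_norm)
  have DD: "D * cnj D = of_real (N\<^sup>2)"
    by (simp add: N_def complex_norm_square[symmetric] del: of_real_power)
  \<comment> \<open>Everything that involves the displacements x and y once (D - x) * (D - y) * cnj
    D is multiplied out.\<close>
  define E where "E = of_real (N\<^sup>2) * (- cnj u * (x + y)) + cnj u * x * y * cnj D"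
  have Re: "N\<^sup>2 = 2 * Re (- cnj u * D)"
  proof -
    have "(Re u)\<^sup>2 + (Im u)\<^sup>2 = 1" "(Re v)\<^sup>2 + (Im v)\<^sup>2 = 1"
      using u v by (simp_all add: norm_complex_def)
    then show ?thesis
      by (simp only: N_def D_def cmod_power2) (simp add: power2_eq_square algebra_simps)
  qed
  have expand: "- cnj u * ((v - a) * (v - b) * cnj (v - u)) = of_real (N\<^sup>2) * (- cnj u * D) - E"
    unfolding E_def DD[symmetric] by (simp add: D_def x_def y_def algebra_simps)
  have "Re E \<le> N\<^sup>2 * (2 * r) + r * r * N"
  proof -
    have "norm (of_real (N\<^sup>2) * (- cnj u * (x + y))) \<le> N\<^sup>2 * (2 * r)"
      using xy u norm_triangle_ineq[of x y]
      by (auto simp: norm_mult norm_power N_def intro!: mult_left_mono)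
    moreover have "norm (cnj u * x * y * cnj D) \<le> r * r * N"
      using xy u by (auto simp: norm_mult N_def intro!: mult_right_mono mult_mono order_trans[OF norm_ge_zero])
    ultimately show ?thesis
      unfolding E_def by (meson complex_Re_le_cmod norm_triangle_ineq order_trans add_mono)
  qed
  \<comment> \<open>From r <= N^2 / 8 and N <= 2 the error is at most N^4/4 + N^4/32, below the main
    term N^4/2.\<close>
  also have "\<dots> < N\<^sup>2 * (N\<^sup>2 / 2)"
  proof -
    have Np: "N > 0" using N d by auto
    have r: "r \<le> N\<^sup>2 / 8" "r \<ge> 0" using N d by (auto simp: r_def intro!: power_mono)
    have "N\<^sup>2 * (2 * r) \<le> N\<^sup>2 * (N\<^sup>2 / 4)" using r by (intro mult_left_mono) auto
    then have "N\<^sup>2 * (2 * r) \<le> N\<^sup>2 * N\<^sup>2 / 4" by simp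
    moreover have "r * r * N \<le> N\<^sup>2 / 8 * (N\<^sup>2 / 8) * 2"
      using r N Np by (intro mult_mono) auto
    then have "r * r * N \<le> N\<^sup>2 * N\<^sup>2 / 32" by simp
    moreover have "N\<^sup>2 * N\<^sup>2 > 0" using Np by auto
    ultimately show ?thesis by linarith
  qed
  also have "\<dots> = N\<^sup>2 * Re (- cnj u * D)" using Re by simp
  also have "\<dots> = Re (of_real (N\<^sup>2) * (- cnj u * D))" by (simp add: algebra_simps)
  finally show ?thesis unfolding expand by simp
qed

section \<open>Monic orthogonal polynomials of a finite measure on the circle: existence and
  uniqueness\<close>

locale circle_measure =
  fixes m :: nat and z :: "nat \<Rightarrow> complex" and w :: "nat \<Rightarrow> real"
  assumes circle: "j \<in> {1..m} \<Longrightarrow> norm (z j) = 1"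
    and inj: "inj_on z {1..m}"
    and w_pos: "j \<in> {1..m} \<Longrightarrow> w j > 0"
begin

text \<open>The predicate under the definite description in \<open>monic_OP\<close>, isolated so
  that existence and uniqueness can be shown for it.\<close>

definition is_OP :: "nat \<Rightarrow> complex poly \<Rightarrow> bool" where
  "is_OP n p \<longleftrightarrow> degree p = n \<and> lead_coeff p = 1 \<and> (\<forall>q. degree q < n \<longrightarrow> disc_ip m z w p q = 0)"

lemma disc_ip_linear:
  "disc_ip m z w (p + q) r = disc_ip m z w p r + disc_ip m z w q r"
  "disc_ip m z w (p - q) r = disc_ip m z w p r - disc_ip m z w q r"
  "disc_ip m z w (smult c p) r = c * disc_ip m z w p r"
  "disc_ip m z w r (p + q) = disc_ip m z w r p + disc_ip m z w r q"
  "disc_ip m z w r (smult c p) = cnj c * disc_ip m z w r p"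
  by (simp_all add: disc_ip_def algebra_simps sum.distrib sum_subtractf sum_distrib_left)

lemma disc_ip_sum_left:
  "disc_ip m z w (\<Sum>i\<in>I. f i) r = (\<Sum>i\<in>I. disc_ip m z w (f i) r)"
  by (induction I rule: infinite_finite_induct) (simp_all add: disc_ip_linear, simp_all add: disc_ip_def)

text \<open>Real parts turn the sum into a vanishing sum of nonnegative terms, so p has more zeros
  than its degree allows. The case \<open>c = 1\<close> is positive definiteness; general c serves
  the half-plane argument that separates zeros.\<close>

lemma poly_eq_0_if_weighted_sum_eq_0:
  assumes A: "A \<subseteq> {1..m}" and deg: "degree p < card A"
    and pos: "\<And>l. l \<in> A \<Longrightarrow> 0 < Re (c l)"
    and sum: "(\<Sum>l\<in>A. of_real (w l * (norm (poly p (z l)))\<^sup>2) * c l) = 0"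
  shows "p = 0"
proof (rule ccontr)
  assume "p \<noteq> 0"
  have fin: "finite A" using A finite_subset by blast
  have w: "w l > 0" if "l \<in> A" for l using A w_pos that by blast
  have sum_Re: "(\<Sum>l\<in>A. w l * (norm (poly p (z l)))\<^sup>2 * Re (c l)) = 0"
    using arg_cong[OF sum, of Re] by simp
  have nonneg: "0 \<le> w l * (norm (poly p (z l)))\<^sup>2 * Re (c l)" if "l \<in> A" for l
    using w[OF that] pos[OF that] by simp
  have "\<forall>l\<in>A. w l * (norm (poly p (z l)))\<^sup>2 * Re (c l) = 0"
    by (rule iffD1[OF sum_nonneg_eq_0_iff[OF fin nonneg] sum_Re])
  then have "z ` A \<subseteq> {x. poly p x = 0}" using w pos by fastforce
  then have "card (z ` A) \<le> card {x. poly p x = 0}"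
    by (intro card_mono poly_roots_finite \<open>p \<noteq> 0\<close>)
  then show False
    using card_poly_roots_bound[OF \<open>p \<noteq> 0\<close>] deg card_image[OF inj_on_subset[OF inj A]] by simp
qed

lemma disc_ip_self: "disc_ip m z w p p = (\<Sum>l=1..m. of_real (w l * (norm (poly p (z l)))\<^sup>2))"
  by (simp add: disc_ip_def complex_norm_square mult.assoc del: of_real_power)

lemma disc_ip_self_eq_0D: "disc_ip m z w p p = 0 \<Longrightarrow> degree p < m \<Longrightarrow> p = 0"
  by (rule poly_eq_0_if_weighted_sum_eq_0[where A = "{1..m}" and c = "\<lambda>_. 1"])
    (auto simp: disc_ip_self)

text \<open>Subtracting \<open>lead_coeff q\<close> times \<open>P (degree q)\<close> cancels the
  leading term, so induction on the degree reduces every q to the basis.\<close>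

lemma disc_ip_eq_0_if_basis:
  assumes P: "\<And>i. i < n \<Longrightarrow> degree (P i) = i \<and> lead_coeff (P i) = 1 \<and> disc_ip m z w p (P i) = 0"
    and "degree q < n"
  shows "disc_ip m z w p q = 0"
  using \<open>degree q < n\<close>
proof (induction "degree q" arbitrary: q rule: less_induct)
  case less
  define q' where "q' = q - smult (lead_coeff q) (P (degree q))"
  have Pq: "degree (P (degree q)) = degree q" "lead_coeff (P (degree q)) = 1"
      "disc_ip m z w p (P (degree q)) = 0"
    using P[OF less.prems] by blast+
  have q: "q = q' + smult (lead_coeff q) (P (degree q))" by (simp add: q'_def)
  have le: "degree q' \<le> degree q" unfolding q'_def
    using Pq by (intro degree_diff_le) (auto intro: order_trans[OF degree_smult_le])
  have c: "coeff q' (degree q) = 0" using Pq by (simp add: q'_def)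
  have "disc_ip m z w p q' = 0"
  \<comment> \<open>For constant q the remainder is zero and its degree, 0 by convention, does not
    drop.\<close>
  proof (cases "q' = 0")
    case True
    then show ?thesis by (simp add: disc_ip_def)
  next
    case False
    then have "degree q' \<noteq> degree q" using c by (metis leading_coeff_0_iff)
    then show ?thesis using le less by auto
  qed
  then show ?case by (subst q) (simp add: disc_ip_linear Pq)
qed

text \<open>Gram-Schmidt on the monomial of degree n. The denominators are nonzero because each
  \<open>P i\<close> has degree below n <= m.\<close>

lemma is_OP_exists: "n \<le> m \<Longrightarrow> \<exists>p. is_OP n p"
proof (induction n rule: less_induct)
  case (less n)
  then have "\<forall>i\<in>{..<n}. \<exists>p. is_OP i p" by auto
  then obtain P where P: "is_OP i (P i)" if "i < n" for i
    by (metis lessThan_iff)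
  define X where "X = monom (1::complex) n"
  define c where "c i = disc_ip m z w X (P i) / disc_ip m z w (P i) (P i)" for i
  define S where "S = (\<Sum>i<n. smult (c i) (P i))"
  have dS: "coeff S i = 0" if "i \<ge> n" for i
    unfolding S_def using P that by (auto simp: is_OP_def coeff_sum intro!: sum.neutral coeff_eq_0)
  have top: "coeff (X - S) n = 1" using dS by (simp add: X_def)
  have "degree (X - S) = n"
  proof (rule antisym)
    show "degree (X - S) \<le> n" using dS by (intro degree_le) (auto simp: X_def)
    show "n \<le> degree (X - S)" using top by (intro le_degree) auto
  qed
  moreover have "disc_ip m z w (X - S) q = 0" if "degree q < n" for q
  proof (rule disc_ip_eq_0_if_basis[OF _ that, of P])
    fix i assume i: "i < n"
    have orth: "disc_ip m z w (P k) (P i) = 0" if "k < n" "k \<noteq> i" for k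
    proof (cases "i < k")
      case True
      then show ?thesis using P[OF that(1)] P[OF i] by (auto simp: is_OP_def)
    next
      case False
      \<comment> \<open>Here k < i, so orthogonality is known only in the opposite order and is
        transferred by conjugate symmetry.\<close>
      have "disc_ip m z w (P i) (P k) = 0" using P[OF that(1)] P[OF i] that False by (auto simp: is_OP_def)
      moreover have "disc_ip m z w (P k) (P i) = cnj (disc_ip m z w (P i) (P k))"
        by (simp add: disc_ip_def mult_ac)
      ultimately show ?thesis by simp
    qed
    have "disc_ip m z w (P i) (P i) \<noteq> 0"
      using disc_ip_self_eq_0D[of "P i"] P[OF i] i less.prems by (auto simp: is_OP_def)
    moreover have "disc_ip m z w S (P i) = c i * disc_ip m z w (P i) (P i)"
      unfolding S_def using i orth
      by (simp add: disc_ip_sum_left disc_ip_linear sum.remove[of _ i])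
    ultimately have "disc_ip m z w (X - S) (P i) = 0"
      by (simp add: disc_ip_linear c_def)
    then show "degree (P i) = i \<and> lead_coeff (P i) = 1 \<and> disc_ip m z w (X - S) (P i) = 0"
      using P[OF i] by (auto simp: is_OP_def)
  qed
  ultimately show ?case using top by (auto simp: is_OP_def)
qed

text \<open>The leading terms cancel in the difference, which is therefore orthogonal to itself and
  vanishes by definiteness in degrees below m.\<close>

lemma is_OP_unique:
  assumes n: "1 \<le> n" "n \<le> m" and p: "is_OP n p" and q: "is_OP n q"
  shows "p = q"
proof -
  have "degree (p - q) < n"
  proof (rule degree_lessI)
    show "p - q \<noteq> 0 \<or> 0 < n" using n by auto
    show "\<forall>i\<ge>n. coeff (p - q) i = 0"
      using p q by (auto simp: is_OP_def coeff_eq_0 le_less)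
  qed
  moreover from this have "disc_ip m z w (p - q) (p - q) = 0"
    using p q by (simp add: disc_ip_linear(2) is_OP_def)
  ultimately have "p - q = 0" using n by (intro disc_ip_self_eq_0D) auto
  then show ?thesis by simp
qed

lemma monic_OP_is_OP:
  assumes "1 \<le> n" "n \<le> m"
  shows "is_OP n (monic_OP m z w n)"
proof -
  have "\<exists>!p. is_OP n p" using is_OP_exists is_OP_unique assms by blast
  then show ?thesis unfolding monic_OP_def is_OP_def[symmetric] by (rule theI')
qed

section \<open>Zeros of the orthogonal polynomials and their values at the nodes\<close>

lemma is_OP_zero_in_disc:
  assumes p: "is_OP n p" and n: "n \<le> m" and x: "poly p x = 0"
  shows "norm x \<le> 1"
proof -
  obtain q where q: "p = [:-x, 1:] * q" using x by (metis poly_eq_0_iff_dvd dvdE)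
  have lp: "lead_coeff p = 1" using p unfolding is_OP_def by blast
  note f = monic_linear_factor[OF q lp]
  have dq: "degree q < n" using f p by (simp add: is_OP_def)
  define N where "N = (\<Sum>l=1..m. w l * (norm (poly q (z l)))\<^sup>2)"
  have N: "disc_ip m z w q q = of_real N" by (simp add: disc_ip_self N_def)
  have "N \<ge> 0" unfolding N_def by (intro sum_nonneg) (simp add: w_pos less_imp_le)
  moreover have "N \<noteq> 0"
    using disc_ip_self_eq_0D[of q] N dq n f by auto
  ultimately have Np: "N > 0" by simp
  have "0 = disc_ip m z w p q" using p dq by (simp add: is_OP_def)
  \<comment> \<open>Orthogonality of (X - x) q to q exhibits x as the mean of the nodes with weights
    w l * |q(z l)|^2.\<close>
  also have "\<dots> = (\<Sum>l=1..m. z l * of_real (w l * (norm (poly q (z l)))\<^sup>2)) - x * disc_ip m z w q q"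
    unfolding disc_ip_self sum_distrib_left sum_subtractf[symmetric]
    by (simp add: disc_ip_def q complex_norm_square algebra_simps del: of_real_power)
  finally have "x * of_real N = (\<Sum>l=1..m. z l * of_real (w l * (norm (poly q (z l)))\<^sup>2))"
    by (simp add: N)
  then have "norm x * N = norm (\<Sum>l=1..m. z l * of_real (w l * (norm (poly q (z l)))\<^sup>2))"
    using Np by (metis abs_of_pos norm_mult norm_of_real)
  also have "\<dots> \<le> (\<Sum>l=1..m. norm (z l * of_real (w l * (norm (poly q (z l)))\<^sup>2)))"
    by (rule norm_sum)
  also have "\<dots> = N"
    unfolding N_def by (intro sum.cong refl) (simp add: norm_mult norm_power circle w_pos less_imp_le)
  finally show ?thesis using Np by simp
qed

lemma is_OP_norm_le:
  assumes p: "is_OP n p" and n: "n \<le> m" and u: "norm u \<le> 1"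
  shows "norm (poly p u) \<le> 2 ^ n"
proof -
  have "dist x u \<le> 2" if "poly p x = 0" for x
    using is_OP_zero_in_disc[OF p n that] u norm_triangle_ineq4[of x u] by (simp add: dist_norm)
  then show ?thesis using norm_monic_poly_le[of p u 2] p by (auto simp: is_OP_def)
qed

text \<open>The radius depends on the nodes alone, so later one \<open>r0\<close> serves every t.
  The points a and b may coincide, which also excludes a double zero.\<close>

lemma is_OP_no_two_zeros_near:
  assumes p: "is_OP n p" and n: "n \<le> m" and j: "j \<in> {1..m}"
    and d: "0 < d" "\<And>l. l \<in> {1..m} \<Longrightarrow> l \<noteq> j \<Longrightarrow> d \<le> dist (z l) (z j)"
    and ab: "p = [:-a, 1:] * ([:-b, 1:] * s)"
    and a: "dist a (z j) < d\<^sup>2 / 8" and b: "dist b (z j) < d\<^sup>2 / 8"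
  shows False
proof -
  have lp: "lead_coeff p = 1" using p unfolding is_OP_def by blast
  note f1 = monic_linear_factor[OF ab lp]
  note f2 = monic_linear_factor[OF refl f1(1)]
  have deg: "degree p = Suc (Suc (degree s))" and s0: "s \<noteq> 0" using f1 f2 by auto
  have dn: "degree p = n" using p by (simp add: is_OP_def)
  have "degree ([:- z j, 1:] * s) < n"
    using deg dn s0 by (subst degree_mult_eq) auto
  then have "0 = disc_ip m z w p ([:- z j, 1:] * s)"
    using p by (simp add: is_OP_def del: mult_pCons_left)
  also have "\<dots> = (\<Sum>l=1..m. of_real (w l * (norm (poly s (z l)))\<^sup>2)
                       * ((z l - a) * (z l - b) * cnj (z l - z j)))"
    unfolding disc_ip_def ab poly_mult of_real_mult complex_norm_square
    by (intro sum.cong) (simp_all add: complex_norm_square mult_ac del: of_real_power)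
  also have "\<dots> = (\<Sum>l\<in>{1..m} - {j}. of_real (w l * (norm (poly s (z l)))\<^sup>2)
                       * ((z l - a) * (z l - b) * cnj (z l - z j)))"
    using j by (simp add: sum.remove[of _ j])
  \<comment> \<open>The factor \<open>- cnj (z j)\<close> rotates the half-plane containing all
    terms onto the right one.\<close>
  finally have sum: "(\<Sum>l\<in>{1..m} - {j}. of_real (w l * (norm (poly s (z l)))\<^sup>2)
                       * (- cnj (z j) * ((z l - a) * (z l - b) * cnj (z l - z j)))) = 0"
    by (subst mult.left_commute) (simp add: sum_distrib_left[symmetric] sum_negf del: of_real_mult)
  have pos: "0 < Re (- cnj (z j) * ((z l - a) * (z l - b) * cnj (z l - z j)))"
    if "l \<in> {1..m} - {j}" for l
    using that d a b circle j by (intro Re_circle_perturbation_pos[where d = d]) auto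
  \<comment> \<open>Node j is lost, but s has degree n - 2, still below m - 1.\<close>
  have "degree s < card ({1..m} - {j})" using deg dn n j by simp
  from poly_eq_0_if_weighted_sum_eq_0[OF Diff_subset this pos sum] have "s = 0" .
  then show False using s0 by simp
qed

text \<open>If all n zeros had distance at least r from \<open>z j\<close>, the value there would be
  at least r^n. After the near zero x is split off, the other n - 1 zeros stay at distance r, so |x
  - z j| is |p(z j)| divided by at least r^(n-1).\<close>

lemma is_OP_zero_near:
  assumes p: "is_OP n p" and n: "n \<le> m" "1 \<le> n" and j: "j \<in> {1..m}"
    and d: "0 < d" "\<And>l. l \<in> {1..m} \<Longrightarrow> l \<noteq> j \<Longrightarrow> d \<le> dist (z l) (z j)"
    and r: "0 < r" "r \<le> d\<^sup>2 / 8"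
    and small: "norm (poly p (z j)) < r ^ n"
  shows "\<exists>x. dist x (z j) < r \<and> poly p x = 0 \<and> order x p = 1 \<and>
    (\<forall>u. dist u (z j) < r \<and> poly p u = 0 \<longrightarrow> u = x) \<and>
    norm (x - z j) \<le> norm (poly p (z j)) / r ^ (n - 1)"
proof -
  have dn: "degree p = n" and lp: "lead_coeff p = 1" using p by (auto simp: is_OP_def)
  have p0: "p \<noteq> 0" using lp by auto
  obtain x where x: "dist x (z j) < r" "poly p x = 0"
    using norm_monic_poly_ge[of p r "z j"] small lp dn r by (metis less_imp_le not_le)
  obtain q where q: "p = [:-x, 1:] * q" using x(2) by (metis poly_eq_0_iff_dvd dvdE)
  note f = monic_linear_factor[OF q lp]
  have q_zero: "r \<le> dist u (z j)" if "poly q u = 0" for u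
  proof (rule ccontr)
    assume "\<not> r \<le> dist u (z j)"
    moreover obtain s where "q = [:-u, 1:] * s" using \<open>poly q u = 0\<close> by (metis poly_eq_0_iff_dvd dvdE)
    ultimately show False
      using is_OP_no_two_zeros_near[OF p n(1) j d, of x u s] x q r by auto
  qed
  \<comment> \<open>Applied to x itself, the separation of the zeros of q gives simplicity.\<close>
  have "poly q x \<noteq> 0" using q_zero x by fastforce
  then have "order x q = 0" by (simp add: order_root)
  moreover have "order x p = order x [:-x, 1:] + order x q"
    using p0 unfolding q by (rule order_mult)
  moreover have "order x [:-x, 1:] = 1"
    using order_power_n_n[of x 1] by simp
  ultimately have "order x p = 1" by simp
  moreover have "u = x" if "dist u (z j) < r" "poly p u = 0" for u
    using that q_zero[of u] by (auto simp: q)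
  moreover have "norm (x - z j) \<le> norm (poly p (z j)) / r ^ (n - 1)"
  proof -
    have "r ^ (n - 1) \<le> norm (poly q (z j))"
      using norm_monic_poly_ge[of q r "z j"] f q_zero r dn by auto
    then have "norm (x - z j) * r ^ (n - 1) \<le> norm (x - z j) * norm (poly q (z j))"
      by (rule mult_left_mono) simp
    also have "\<dots> = norm (poly p (z j))"
      by (simp add: q norm_mult[symmetric] norm_minus_commute algebra_simps del: norm_mult)
    finally show ?thesis using r by (simp add: field_simps)
  qed
  ultimately show ?thesis using x by blast
qed

text \<open>The test polynomial vanishes at the first k nodes except j, so the value at
  \<open>z j\<close> is balanced only by the nodes beyond k.\<close>

lemma is_OP_small_at_node:
  assumes p: "is_OP n p" and n: "n \<le> m" and k: "k < n" and j: "j \<in> {1..k}"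
    and d: "0 < d" "d \<le> 1" "\<And>l. l \<in> {1..m} \<Longrightarrow> l \<noteq> j \<Longrightarrow> d \<le> dist (z l) (z j)"
  shows "w j * norm (poly p (z j)) \<le> (\<Sum>l\<in>{k<..m}. w l) * (4 / d) ^ n"
proof -
  define I where "I = {1..k} - {j}"
  define q where "q = (\<Prod>i\<in>I. [:- z i, 1:])"
  have pq: "poly q u = (\<Prod>i\<in>I. u - z i)" for u by (simp add: q_def poly_prod)
  have fin: "finite I" by (simp add: I_def)
  have cI: "card I \<le> n" using j k by (simp add: I_def)
  have "degree q = card I" unfolding q_def by (subst degree_prod_sum_eq) auto
  then have "degree q < n" using j k by (simp add: I_def)
  then have "0 = disc_ip m z w p q" using p by (simp add: is_OP_def)
  also have "\<dots> = (\<Sum>l\<in>insert j {k<..m}. of_real (w l) * poly p (z l) * cnj (poly q (z l)))"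
    unfolding disc_ip_def
  proof (rule sum.mono_neutral_right)
    show "insert j {k<..m} \<subseteq> {1..m}" using j k n by auto
    show "\<forall>i\<in>{1..m} - insert j {k<..m}. of_real (w i) * poly p (z i) * cnj (poly q (z i)) = 0"
    proof
      fix i assume "i \<in> {1..m} - insert j {k<..m}"
      then have "i \<in> I" by (auto simp: I_def)
      then have "poly q (z i) = 0" using fin by (auto simp: pq)
      then show "of_real (w i) * poly p (z i) * cnj (poly q (z i)) = 0" by simp
    qed
  qed simp
  also have "\<dots> = of_real (w j) * poly p (z j) * cnj (poly q (z j))
     + (\<Sum>l\<in>{k<..m}. of_real (w l) * poly p (z l) * cnj (poly q (z l)))"
    using j by (subst sum.insert) auto
  finally have "of_real (w j) * poly p (z j) * cnj (poly q (z j)) =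
      - (\<Sum>l\<in>{k<..m}. of_real (w l) * poly p (z l) * cnj (poly q (z l)))"
    by (simp add: eq_neg_iff_add_eq_0)
  then have "norm (of_real (w j) * poly p (z j) * cnj (poly q (z j))) =
      norm (\<Sum>l\<in>{k<..m}. of_real (w l) * poly p (z l) * cnj (poly q (z l)))"
    by simp
  \<comment> \<open>One 2^n bounds p on the circle, the other bounds the at most n factors of q,
    each of modulus at most 2.\<close>
  also have "\<dots> \<le> (\<Sum>l\<in>{k<..m}. w l * (2 ^ n * 2 ^ n))"
  proof (rule sum_norm_le)
    fix l assume "l \<in> {k<..m}"
    then have l: "l \<in> {1..m}" by auto
    have "norm (poly q (z l)) \<le> (\<Prod>i\<in>I. 2)"
      unfolding pq prod_norm[symmetric]
    proof (intro prod_mono conjI norm_ge_zero)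
      fix i assume "i \<in> I"
      then have "i \<in> {1..m}" using k n by (auto simp: I_def)
      then show "norm (z l - z i) \<le> 2"
        using l circle norm_triangle_ineq4[of "z l" "z i"] by simp
    qed
    also have "\<dots> \<le> 2 ^ n" using cI by (simp add: power_increasing)
    finally show "norm (of_real (w l) * poly p (z l) * cnj (poly q (z l))) \<le> w l * (2 ^ n * 2 ^ n)"
      using is_OP_norm_le[OF p n, of "z l"] circle[OF l] w_pos[OF l]
      by (auto simp: norm_mult mult.assoc intro!: mult_mono)
  qed
  also have "\<dots> = (\<Sum>l\<in>{k<..m}. w l) * 4 ^ n"
    by (simp add: sum_distrib_right power_mult_distrib[symmetric])
  finally have *: "w j * norm (poly p (z j)) * norm (poly q (z j)) \<le> (\<Sum>l\<in>{k<..m}. w l) * 4 ^ n"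
    using w_pos[of j] j k n by (simp add: norm_mult)
  \<comment> \<open>Since d <= 1, the exponent can be raised to n, making the bound independent of
    k.\<close>
  have "d ^ n \<le> d ^ card I" using d cI by (intro power_decreasing) auto
  also have "\<dots> = (\<Prod>i\<in>I. d)" by simp
  also have "\<dots> \<le> norm (poly q (z j))"
    unfolding pq prod_norm[symmetric]
  proof (intro prod_mono conjI)
    fix i assume "i \<in> I"
    then have "i \<in> {1..m}" "i \<noteq> j" using k n by (auto simp: I_def)
    then show "d \<le> norm (z j - z i)" using d(3)[of i] by (simp add: dist_norm norm_minus_commute)
  qed (use d in simp)
  finally have "w j * norm (poly p (z j)) * d ^ n \<le> w j * norm (poly p (z j)) * norm (poly q (z j))"
    using w_pos[of j] j k n by (intro mult_left_mono) auto
  also note *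
  finally show ?thesis using d by (simp add: field_simps power_divide)
qed

end

section \<open>Separation of the nodes and the boundary of a K-group\<close>

lemma finite_inj_on_separated:
  fixes z :: "nat \<Rightarrow> 'a :: metric_space"
  assumes "finite I" "inj_on z I"
  obtains d :: real where "0 < d" "d \<le> 1"
    "\<And>i j. i \<in> I \<Longrightarrow> j \<in> I \<Longrightarrow> i \<noteq> j \<Longrightarrow> d \<le> dist (z i) (z j)"
proof -
  \<comment> \<open>The element 1 keeps S nonempty when there are no pairs, and forces the minimum
    to be at most 1.\<close>
  define S where "S = insert 1 ((\<lambda>(i, j). dist (z i) (z j)) ` {(i, j). i \<in> I \<and> j \<in> I \<and> i \<noteq> j})"
  have "finite {(i, j). i \<in> I \<and> j \<in> I \<and> i \<noteq> j}"
    by (rule finite_subset[of _ "I \<times> I"]) (use assms in auto)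
  then have fin: "finite S" by (simp add: S_def)
  show ?thesis
  proof
    show "0 < Min S" using fin assms(2) by (auto simp: S_def inj_on_def)
    show "Min S \<le> 1" using fin by (auto simp: S_def)
    show "Min S \<le> dist (z i) (z j)" if "i \<in> I" "j \<in> I" "i \<noteq> j" for i j
      using fin that by (intro Min_le) (auto simp: S_def)
  qed
qed

lemma kgroup_prev_less: "1 \<le> n \<Longrightarrow> kgroup_prev z G n < n"
  and kgroup_prev_const: "1 \<le> n \<Longrightarrow> l \<in> {kgroup_prev z G n + 1..n} \<Longrightarrow> G (z l) = G (z n)"
  and kgroup_prev_neq: "1 \<le> n \<Longrightarrow> 1 \<le> kgroup_prev z G n \<Longrightarrow> G (z (kgroup_prev z G n)) \<noteq> G (z n)"
proof -
  let ?P = "\<lambda>k. k < n \<and> (\<forall>l\<in>{k+1..n}. G (z l) = G (z n))"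
  assume n: "1 \<le> n"
  have "?P (n - 1)" using n by auto
  then have k: "?P (kgroup_prev z G n)" unfolding kgroup_prev_def by (rule LeastI)
  then show "kgroup_prev z G n < n" by simp
  show "G (z l) = G (z n)" if "l \<in> {kgroup_prev z G n + 1..n}" using k that by blast
  show "G (z (kgroup_prev z G n)) \<noteq> G (z n)" if "1 \<le> kgroup_prev z G n"
  proof
    assume eq: "G (z (kgroup_prev z G n)) = G (z n)"
    \<comment> \<open>If G did not jump at the boundary, the block could be extended by one index,
      against minimality.\<close>
    have "?P (kgroup_prev z G n - 1)"
    proof (intro conjI ballI)
      fix l assume "l \<in> {kgroup_prev z G n - 1 + 1..n}"
      then have "l = kgroup_prev z G n \<or> l \<in> {kgroup_prev z G n + 1..n}" by auto
      then show "G (z l) = G (z n)" using k eq by blast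
    qed (use k in linarith)
    then have "kgroup_prev z G n \<le> kgroup_prev z G n - 1"
      unfolding kgroup_prev_def by (rule Least_le[of ?P])
    then show False using that by simp
  qed
qed

section \<open>Tilted weights and constants uniform in t\<close>

theorem theorem3p3:
  fixes m n :: nat and z :: "nat \<Rightarrow> complex" and mu :: "nat \<Rightarrow> real"
    and G :: "complex \<Rightarrow> real"
  assumes circle: "\<forall>j\<in>{1..m}. norm (z j) = 1"
    and distinct: "inj_on z {1..m}"
    and mu_pos: "\<forall>j\<in>{1..m}. mu j > 0"
    and mu_sum: "(\<Sum>j=1..m. mu j) = 1"
    and sorted: "\<forall>i\<in>{1..m}. \<forall>j\<in>{1..m}. i \<le> j \<longrightarrow> G (z j) \<le> G (z i)"
    and n: "1 \<le> n" "n \<le> m"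
  shows "\<exists>r0 > 0. \<exists>T \<ge> 0. \<exists>C. \<forall>t \<ge> T. \<forall>j\<in>{1..kgroup_prev z G n}.
     (\<exists>w. dist w (z j) < r0 \<and>
          poly (monic_OP m z (tilted_weights m z mu G t) n) w = 0 \<and>
          order w (monic_OP m z (tilted_weights m z mu G t) n) = 1 \<and>
          (\<forall>u. dist u (z j) < r0 \<and> poly (monic_OP m z (tilted_weights m z mu G t) n) u = 0
                \<longrightarrow> u = w) \<and>
          norm (w - z j) \<le> C * exp (t * (G (z n) - G (z j))))"
proof -
  define k where "k = kgroup_prev z G n"
  have kn: "k < n" using kgroup_prev_less n by (simp add: k_def)
  \<comment> \<open>The jump of G just above the group of n; by sorting, every j <= k is at least
    this far above \<open>G (z n)\<close>. For k = 0 there is no such j and the value of g is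
    irrelevant.\<close>
  define g where "g = G (z k) - G (z n)"
  have g: "g > 0" if "1 \<le> k"
    using kgroup_prev_neq[of n z G] n sorted[rule_format, of k n] that kn by (auto simp: k_def g_def)
  have gap: "G (z n) - G (z j) \<le> - g" if "j \<in> {1..k}" for j
    using sorted[rule_format, of j k] that kn n by (auto simp: g_def)
  obtain d where d: "0 < d" "d \<le> 1"
    "\<And>i j. i \<in> {1..m} \<Longrightarrow> j \<in> {1..m} \<Longrightarrow> i \<noteq> j \<Longrightarrow> d \<le> dist (z i) (z j)"
    using finite_inj_on_separated[OF _ distinct] by auto
  define r where "r = d\<^sup>2 / 8"
  have r: "r > 0" using d by (simp add: r_def)
  define M where "M = Min (mu ` {1..m})"
  have M: "M > 0" "\<And>j. j \<in> {1..m} \<Longrightarrow> M \<le> mu j"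
    using mu_pos n by (auto simp: M_def)
  define B where "B = (4 / d) ^ n / M"
  have B: "B > 0" using d M by (simp add: B_def)
  \<comment> \<open>Solves B * exp (- g * t) <= r^n / 2, which puts the value at each node strictly
    below the threshold r^n of \<open>is_OP_zero_near\<close>.\<close>
  define T where "T = max 0 (ln (2 * B / r ^ n) / g)"
  have T: "T \<ge> 0" by (simp add: T_def)
  have main: "norm (poly (monic_OP m z (tilted_weights m z mu G t) n) (z j))
      \<le> B * exp (t * (G (z n) - G (z j)))" (is "norm (poly ?p _) \<le> _")
    and cm: "circle_measure m z (tilted_weights m z mu G t)"
    if t: "t \<ge> 0" and j: "j \<in> {1..k}" for t j
  proof -
    define Z where "Z = (\<Sum>l=1..m. exp (t * G (z l)) * mu l)"
    have Z: "Z > 0" unfolding Z_def using mu_pos n by (intro sum_pos) auto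
    have w: "tilted_weights m z mu G t l = exp (t * G (z l)) * mu l / Z" for l
      by (simp add: tilted_weights_def Z_def)
    show "circle_measure m z (tilted_weights m z mu G t)"
      using circle distinct mu_pos Z by unfold_locales (auto simp: w)
    then interpret circle_measure m z "tilted_weights m z mu G t" .
    have jm: "j \<in> {1..m}" using j kn n by auto
    \<comment> \<open>Beyond k, G is at most \<open>G (z n)\<close>: indices up to n share its
      group, later ones follow by sorting.\<close>
    have "(\<Sum>l\<in>{k<..m}. tilted_weights m z mu G t l) \<le> (\<Sum>l\<in>{k<..m}. exp (t * G (z n)) / Z * mu l)"
    proof (rule sum_mono)
      fix l assume l: "l \<in> {k<..m}"
      have "G (z l) \<le> G (z n)"
      proof (cases "l \<le> n")
        case True
        then show ?thesis using kgroup_prev_const[of n l z G] n l by (auto simp: k_def)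
      next
        case False
        then show ?thesis using sorted[rule_format, of n l] n l by auto
      qed
      then have "exp (t * G (z l)) \<le> exp (t * G (z n))" using t by (simp add: mult_left_mono)
      then show "tilted_weights m z mu G t l \<le> exp (t * G (z n)) / Z * mu l"
        using Z mu_pos[rule_format, of l] l
        by (auto simp: w field_simps intro!: mult_right_mono)
    qed
    also have "\<dots> = exp (t * G (z n)) / Z * (\<Sum>l\<in>{k<..m}. mu l)"
      by (simp add: sum_distrib_left)
    also have "\<dots> \<le> exp (t * G (z n)) / Z * (\<Sum>l=1..m. mu l)"
      using Z mu_pos by (intro mult_left_mono sum_mono2) (auto simp: less_imp_le)
    also have "\<dots> = exp (t * G (z n)) / Z" by (subst mu_sum) simp
    finally have S: "(\<Sum>l\<in>{k<..m}. tilted_weights m z mu G t l) \<le> exp (t * G (z n)) / Z" .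
    have "exp (t * G (z j)) * M / Z * norm (poly ?p (z j))
        \<le> tilted_weights m z mu G t j * norm (poly ?p (z j))"
      using M(2)[OF jm] Z by (intro mult_right_mono) (auto simp: w field_simps)
    also have "\<dots> \<le> (\<Sum>l\<in>{k<..m}. tilted_weights m z mu G t l) * (4 / d) ^ n"
      using is_OP_small_at_node[OF monic_OP_is_OP[OF n] n(2) kn j d(1,2)] d(3) jm by auto
    also have "\<dots> \<le> exp (t * G (z n)) / Z * (4 / d) ^ n"
      using S d by (intro mult_right_mono) auto
    \<comment> \<open>The normalization Z, common to both sides, cancels.\<close>
    finally have "exp (t * G (z j)) * M * norm (poly ?p (z j)) \<le> exp (t * G (z n)) * (4 / d) ^ n"
      using Z by (simp add: divide_le_cancel)
    then show "norm (poly ?p (z j)) \<le> B * exp (t * (G (z n) - G (z j)))"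
      using M(1) d(1) by (simp add: B_def right_diff_distrib exp_diff field_simps)
  qed
  show ?thesis
  proof (rule exI[of _ r], rule conjI[OF r], rule exI[of _ T], rule conjI[OF T],
      rule exI[of _ "B / r ^ (n - 1)"], intro allI impI ballI)
    fix t j assume t: "T \<le> t" and "j \<in> {1..kgroup_prev z G n}"
    then have j: "j \<in> {1..k}" by (simp add: k_def)
    have jm: "j \<in> {1..m}" using j kn n by auto
    have t0: "t \<ge> 0" using t by (simp add: T_def)
    have g0: "g > 0" using g j by auto
    have small: "B * exp (t * (G (z n) - G (z j))) < r ^ n"
    proof -
      have "t * (G (z n) - G (z j)) \<le> t * (- g)"
        using gap[OF j] t0 by (rule mult_left_mono)
      also have "\<dots> \<le> - ln (2 * B / r ^ n)"
        using t g0 by (simp add: T_def field_simps)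
      finally have "B * exp (t * (G (z n) - G (z j))) \<le> B * exp (- ln (2 * B / r ^ n))"
        using B by simp
      also have "\<dots> = r ^ n / 2" using B r by (simp add: exp_minus field_simps)
      also have "\<dots> < r ^ n" using r by simp
      finally show ?thesis .
    qed
    interpret circle_measure m z "tilted_weights m z mu G t" using cm[OF t0 j] .
    let ?p = "monic_OP m z (tilted_weights m z mu G t) n"
    have "d \<le> dist (z l) (z j)" if "l \<in> {1..m}" "l \<noteq> j" for l
      using d(3) that jm by blast
    from is_OP_zero_near[OF monic_OP_is_OP[OF n] n(2,1) jm d(1) this r _
        order_le_less_trans[OF main[OF t0 j] small]]
    obtain x where x: "dist x (z j) < r" "poly ?p x = 0" "order x ?p = 1"
      "\<forall>u. dist u (z j) < r \<and> poly ?p u = 0 \<longrightarrow> u = x"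
      "norm (x - z j) \<le> norm (poly ?p (z j)) / r ^ (n - 1)"
      unfolding r_def by blast
    have "norm (poly ?p (z j)) / r ^ (n - 1) \<le> B * exp (t * (G (z n) - G (z j))) / r ^ (n - 1)"
      using main[OF t0 j] r by (intro divide_right_mono) auto
    with x(5) have "norm (x - z j) \<le> B / r ^ (n - 1) * exp (t * (G (z n) - G (z j)))" by simp
    with x show "\<exists>w. dist w (z j) < r \<and> poly ?p w = 0 \<and> order w ?p = 1 \<and>
        (\<forall>u. dist u (z j) < r \<and> poly ?p u = 0 \<longrightarrow> u = w) \<and>
        norm (w - z j) \<le> B / r ^ (n - 1) * exp (t * (G (z n) - G (z j)))" by blast
  qed
qed

end
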